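(* Let $k>0$ be real and let $\lambda,\rho,\alpha,\beta\in\mathbb{C}$ with $\beta\notin\{0,-k,-2k,\dots\}$. Then $$\sum_{n=0}^\infty\frac{(\lambda)_{n,k}}{n!}\,{}_2F_{1,k}\left[\begin{array}{c}\rho-nk,\ \alpha\\ \beta\end{array};x\right]t^n=(1-kt)^{-\frac{\lambda}{k}}F_{1,k}\left(\alpha,\rho,\lambda;\beta;x,-\frac{kxt}{1-kt}\right),$$ where $|x|<\frac1k$ and $\left|\frac{kxt}{1-kt}\right|<\frac1k$.
   Context: For real $k>0$, $a\in\mathbb{C}$ and an integer $n\ge 1$, the Pochhammer $k$-symbol is $(a)_{n,k}=a(a+k)(a+2k)\cdots(a+(n-1)k)$, and $(a)_{0,k}=1$. The $k$-hypergeometric function is $${}_2F_{1,k}\left[\begin{array}{c}\alpha,\ \beta\\ \gamma\end{array};x\right]=\sum_{n=0}^\infty\frac{(\alpha)_{n,k}(\beta)_{n,k}}{(\gamma)_{n,k}}\frac{x^n}{n!},$$ and the first Appell $k$-function is $$F_{1,k}(\alpha,\beta,\beta';\gamma;x,y)=\sum_{m,n=0}^\infty\frac{(\alpha)_{m+n,k}(\beta)_{m,k}(\beta')_{n,k}}{(\gamma)_{m+n,k}}\frac{x^m}{m!}\frac{y^n}{n!},\qquad |x|<\tfrac1k,\ |y|<\tfrac1k,$$ with $\gamma$ such that no denominator vanishes.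
   Formalization: The left series can diverge in the stated region (x=0, λ=k, kt=−5), so the identity is proved wherever that series converges (kt≠1, principal branch), and convergence is proved when also |kt|<1 and |kt(1−kx)|<1. *)

theory Defs
  imports "HOL-Analysis.Analysis"
begin

definition pochhammer_k :: "real \<Rightarrow> complex \<Rightarrow> nat \<Rightarrow> complex" where
  "pochhammer_k k a n = (\<Prod>i<n. a + of_nat i * of_real k)"

definition hypergeo_2F1_k :: "real \<Rightarrow> complex \<Rightarrow> complex \<Rightarrow> complex \<Rightarrow> complex \<Rightarrow> complex" where
  "hypergeo_2F1_k k \<alpha> \<beta> \<gamma> x =
     (\<Sum>n. pochhammer_k k \<alpha> n * pochhammer_k k \<beta> n / pochhammer_k k \<gamma> n * (x ^ n / fact n))"

text \<open>The double series is summed unconditionally over all pairs of indices; for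
  \<open>\<bar>x\<bar>, \<bar>y\<bar> < 1/k\<close> and nonvanishing denominators it converges absolutely.\<close>

definition appell_F1_k ::
  "real \<Rightarrow> complex \<Rightarrow> complex \<Rightarrow> complex \<Rightarrow> complex \<Rightarrow> complex \<Rightarrow> complex \<Rightarrow> complex" where
  "appell_F1_k k \<alpha> \<beta> \<beta>' \<gamma> x y =
     (\<Sum>\<^sub>\<infinity>(m, n)\<in>UNIV.
        pochhammer_k k \<alpha> (m + n) * pochhammer_k k \<beta> m * pochhammer_k k \<beta>' n
          / pochhammer_k k \<gamma> (m + n) * (x ^ m / fact m) * (y ^ n / fact n))"

end

theory Submission
  imports Defs "HOL-Complex_Analysis.Complex_Analysis"
begin

text \<open>
  Scaling parameters and arguments reduces everything to \<open>k = 1\<close>. With \<open>X = k x\<close>, \<open>T = k t\<close> and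
  \<open>h n = F(r - n, a; b; X)\<close>, where \<open>F\<close> is the Gauss series, the series in question is
  \<open>\<Sum>n. (l)\<^sub>n / n! * h n * T ^ n\<close>, a power series in \<open>T\<close>.

  Near \<open>T = 0\<close> the identity is a rearrangement. Expand \<open>(r - n)\<^sub>m\<close> by the Vandermonde formula into a
  combination of the products \<open>(- n)\<^sub>j * (r)\<^bsub>m - j\<^esub>\<close> and sum over \<open>n\<close> first: the binomial series yields
  \<open>(1 - T) powr - (l + j)\<close>, and what remains is the Appell series at \<open>X\<close> and \<open>- X T / (1 - T)\<close>. This
  is \<open>hyp2F1_appell_generating_function_small\<close>; absolute convergence follows from the subexponential
  growth of \<open>(a)\<^sub>n / (b)\<^sub>n\<close>.

  For the convergence claim the growth of \<open>h\<close> has to be known. The contiguous relation of Gauss is a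
  recurrence of order two for \<open>h\<close> whose characteristic roots tend to \<open>1\<close> and \<open>1 - X\<close>, so \<open>h n\<close> grows
  at most like \<open>q ^ n\<close> for every \<open>q > max 1 (norm (1 - X))\<close>; see \<open>hyp2F1_lowered_parameter_growth\<close>.

  The equality is claimed wherever the series converges, and for special parameters this may be far
  beyond the disc of the rearrangement. The right-hand side is holomorphic in \<open>T\<close> where
  \<open>norm X * norm T < norm (1 - T)\<close>, apart from the branch cut of \<open>(1 - T) powr - l\<close>. This region
  meets each disc around 0 in a connected set, so the identity theorem applies inside the disc of
  convergence. On the cut the principal value is the limit from the lower half of the \<open>T\<close>-plane, and
  on the circle of convergence Abel's limit theorem gives the value of the series.
\<close>

section \<open>Geometric growth bounds\<close>

lemma geometric_bound_of_eventual_ratio: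
  fixes u :: "nat \<Rightarrow> real"
  assumes "q > 0" and "eventually (\<lambda>n. u (Suc n) \<le> q * u n) sequentially"
  shows "\<exists>C>0. \<forall>n. u n \<le> C * q ^ n"
proof -
  obtain N where N: "\<And>n. n \<ge> N \<Longrightarrow> u (Suc n) \<le> q * u n"
    using assms(2) by (auto simp: eventually_sequentially)
  define C where "C = 1 + (\<Sum>i\<le>N. \<bar>u i\<bar> / q ^ i)"
  have C: "C > 0"
    unfolding C_def using \<open>q > 0\<close> by (intro add_pos_nonneg sum_nonneg) auto
  have init: "u n \<le> C * q ^ n" if "n \<le> N" for n
  proof -
    have "\<bar>u n\<bar> / q ^ n \<le> (\<Sum>i\<le>N. \<bar>u i\<bar> / q ^ i)"
      using that \<open>q > 0\<close> by (intro member_le_sum) auto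
    then have "\<bar>u n\<bar> / q ^ n \<le> C" by (simp add: C_def)
    then show ?thesis using \<open>q > 0\<close> by (simp add: field_simps)
  qed
  have "u n \<le> C * q ^ n" if "n \<ge> N" for n
    using that
  proof (induction n rule: dec_induct)
    case base
    show ?case by (rule init) simp
  next
    case (step n)
    have "u (Suc n) \<le> q * u n" using step by (intro N)
    also have "\<dots> \<le> q * (C * q ^ n)" using step \<open>q > 0\<close> by (intro mult_left_mono) auto
    finally show ?case by (simp add: mult_ac)
  qed
  with init C show ?thesis by (metis nat_le_linear)
qed

lemma pochhammer_nonzero:
  fixes b :: complex
  assumes "b \<notin> \<int>\<^sub>\<le>\<^sub>0"
  shows "pochhammer b n \<noteq> 0"
  using assms by (auto simp: pochhammer_eq_0_iff)

text \<open>The ratio of consecutive terms is \<open>(a + n) / (b + n)\<close>, which tends to 1. Hence quotients of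
  Pochhammer symbols grow subexponentially, which lets the hypergeometric series be compared with
  geometric series.\<close>

lemma pochhammer_ratio_geometric_bound:
  fixes a b :: complex
  assumes b: "b \<notin> \<int>\<^sub>\<le>\<^sub>0" and "q > 1"
  shows "\<exists>C>0. \<forall>n. norm (pochhammer a n / pochhammer b n) \<le> C * q ^ n"
proof -
  have nz: "b + of_nat n \<noteq> 0" for n
    using b by (metis minus_of_nat_in_nonpos_Ints eq_neg_iff_add_eq_0)
  have "(\<lambda>n. 1 + (a - b) * inverse (b + of_nat n)) \<longlonglongrightarrow> 1 + (a - b) * 0"
    by (intro tendsto_intros filterlim_compose[OF tendsto_inverse_0] tendsto_add_filterlim_at_infinity[OF tendsto_const] tendsto_of_nat)
  moreover have "(a + of_nat n) / (b + of_nat n) = 1 + (a - b) * inverse (b + of_nat n)" for n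
    using nz[of n] by (simp add: field_simps)
  ultimately have "(\<lambda>n. norm ((a + of_nat n) / (b + of_nat n))) \<longlonglongrightarrow> norm (1::complex)"
    by (intro tendsto_norm) simp
  then have "eventually (\<lambda>n. norm ((a + of_nat n) / (b + of_nat n)) < q) sequentially"
    using \<open>q > 1\<close> by (intro order_tendstoD(2)) auto
  then have "eventually (\<lambda>n. norm (pochhammer a (Suc n) / pochhammer b (Suc n))
              \<le> q * norm (pochhammer a n / pochhammer b n)) sequentially"
  proof eventually_elim
    case (elim n)
    have "norm (pochhammer a (Suc n) / pochhammer b (Suc n)) =
       norm ((a + of_nat n) / (b + of_nat n)) * norm (pochhammer a n / pochhammer b n)"
      by (simp add: pochhammer_Suc norm_mult norm_divide mult.commute)
    also have "\<dots> \<le> q * norm (pochhammer a n / pochhammer b n)"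
      using elim by (intro mult_right_mono) auto
    finally show ?case .
  qed
  from geometric_bound_of_eventual_ratio[OF _ this] \<open>q > 1\<close> show ?thesis by simp
qed

lemma pochhammer_over_fact_geometric_bound:
  fixes a :: complex
  assumes "q > 1"
  shows "\<exists>C>0. \<forall>n. norm (pochhammer a n / fact n) \<le> C * q ^ n"
  using pochhammer_ratio_geometric_bound[OF one_notin_nonpos_Ints assms, of a]
  by (simp add: pochhammer_fact[symmetric])

text \<open>The limiting characteristic polynomial has the roots \<open>1\<close> and \<open>w\<close>. In terms of the
  difference \<open>d n = h (n + 1) - h n\<close> the recurrence is asymptotically triangular: \<open>h\<close> is multiplied
  by 1 and \<open>d\<close> by \<open>w\<close>, up to coefficients that tend to 0. So a suitably weighted norm of the pair
  \<open>(h, d)\<close> eventually increases by a factor of at most \<open>q\<close> in every step. This is the upper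
  half of Poincare's theorem on difference equations.\<close>

lemma second_order_recurrence_growth:
  fixes h p s :: "nat \<Rightarrow> complex" and w :: complex
  assumes rec: "eventually (\<lambda>n. h (Suc (Suc n)) = p n * h (Suc n) + s n * h n) sequentially"
    and p: "p \<longlonglongrightarrow> 1 + w" and s: "s \<longlonglongrightarrow> - w"
    and q: "q > 1" "q > norm w"
  shows "\<exists>C>0. \<forall>n. norm (h n) \<le> C * q ^ n"
proof -
  define d where "d n = h (Suc n) - h n" for n
  \<comment> \<open>The weight of \<open>d\<close> has to be so large that the new \<open>d\<close>, which enters both components of the
    norm, is still absorbed by \<open>q\<close>: this needs \<open>(1 + c) * norm w < q * c\<close>.\<close>
  define c where "c = (norm w + 1) / (q - norm w)"
  have c: "c > 0"
    unfolding c_def using q by (auto intro!: divide_pos_pos add_nonneg_pos)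
  have "c * (q - norm w) = norm w + 1"
    using q by (simp add: c_def)
  then have c': "(1 + c) * norm w < q * c"
    by (simp add: algebra_simps)
  define M where "M n = norm (h (Suc n)) + c * norm (d n)" for n
  define e where "e n = p n + s n - 1" for n
  have "e \<longlonglongrightarrow> (1 + w) + (- w) - 1"
    unfolding e_def by (intro tendsto_intros p s)
  then have "(\<lambda>n. 1 + (1 + c) * norm (e n)) \<longlonglongrightarrow> 1 + (1 + c) * norm (0::complex)"
    by (intro tendsto_intros) simp_all
  then have ev1: "eventually (\<lambda>n. 1 + (1 + c) * norm (e n) < q) sequentially"
    using q by (intro order_tendstoD(2)) auto
  have "(\<lambda>n. (1 + c) * norm (s n)) \<longlonglongrightarrow> (1 + c) * norm (- w)"
    by (intro tendsto_intros s)
  then have ev2: "eventually (\<lambda>n. (1 + c) * norm (s n) < q * c) sequentially"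
    using c' by (intro order_tendstoD(2)) auto
  have "eventually (\<lambda>n. M (Suc n) \<le> q * M n) sequentially"
    using rec ev1 ev2
  proof eventually_elim
    case (elim n)
    have dn: "d (Suc n) = e n * h (Suc n) - s n * d n"
      using elim(1) by (simp add: d_def e_def algebra_simps)
    have "norm (d (Suc n)) \<le> norm (e n) * norm (h (Suc n)) + norm (s n) * norm (d n)"
      unfolding dn by (metis norm_mult norm_triangle_ineq4)
    moreover have "norm (h (Suc (Suc n))) \<le> norm (h (Suc n)) + norm (d (Suc n))"
      by (metis d_def diff_add_cancel add.commute norm_triangle_ineq)
    ultimately have "M (Suc n) \<le> norm (h (Suc n)) +
        (1 + c) * (norm (e n) * norm (h (Suc n)) + norm (s n) * norm (d n))"
      using c mult_left_mono[of "norm (d (Suc n))" _ "1 + c"] unfolding M_def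
      by (fastforce simp: algebra_simps)
    also have "\<dots> = (1 + (1 + c) * norm (e n)) * norm (h (Suc n)) + ((1 + c) * norm (s n)) * norm (d n)"
      by (simp add: algebra_simps)
    also have "\<dots> \<le> q * norm (h (Suc n)) + (q * c) * norm (d n)"
      using elim by (intro add_mono mult_right_mono) auto
    finally show ?case by (simp add: M_def algebra_simps)
  qed
  from geometric_bound_of_eventual_ratio[OF _ this] q
  obtain K where K: "K > 0" "\<And>n. M n \<le> K * q ^ n" by auto
  have "norm (h n) \<le> (norm (h 0) + K) * q ^ n" for n
  proof (cases n)
    case (Suc m)
    have "norm (h n) \<le> M m" using c by (simp add: M_def Suc)
    also have "\<dots> \<le> K * q ^ m" by (rule K)
    also have "\<dots> \<le> (norm (h 0) + K) * q ^ n"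
      using K q by (intro mult_mono power_increasing) (auto simp: Suc)
    finally show ?thesis .
  qed (use K in auto)
  moreover have "norm (h 0) + K > 0" using K by (simp add: add_nonneg_pos)
  ultimately show ?thesis by (intro exI[of _ "norm (h 0) + K"]) simp
qed

section \<open>The Gauss series and the lowering of its first parameter\<close>

definition hyp2F1 :: "complex \<Rightarrow> complex \<Rightarrow> complex \<Rightarrow> complex \<Rightarrow> complex" where
  "hyp2F1 a b c z = (\<Sum>n. pochhammer a n * pochhammer b n / pochhammer c n * (z ^ n / fact n))"

text \<open>In the series below the growth bounds are applied to two factors of a term at a time and so cost
  a factor \<open>q\<^sup>2\<close> per index; a ratio \<open>M\<close> below 1 leaves room for it.\<close>

lemma exists_square_factor_above_1:
  fixes M :: real
  assumes "M < 1"
  shows "\<exists>q>1. q ^ 2 * M < 1"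
proof -
  have "((\<lambda>q. q ^ 2 * M) \<longlongrightarrow> 1 ^ 2 * M) (at_right 1)"
    by (intro tendsto_intros)
  then have "eventually (\<lambda>q. q ^ 2 * M < 1) (at_right 1)"
    using assms by (intro order_tendstoD(2)) auto
  then have "eventually (\<lambda>q. q > 1 \<and> q ^ 2 * M < 1) (at_right 1)"
    by (intro eventually_conj eventually_at_right_less)
  then show ?thesis
    by (rule eventually_happens'[OF trivial_limit_at_right_real])
qed

lemma hyp2F1_abs_summable:
  fixes a b c z :: complex
  assumes c: "c \<notin> \<int>\<^sub>\<le>\<^sub>0" and z: "norm z < 1"
  shows "summable (\<lambda>n. norm (pochhammer a n * pochhammer b n / pochhammer c n * (z ^ n / fact n)))"
proof -
  obtain q where q: "q > 1" "q ^ 2 * norm z < 1"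
    using exists_square_factor_above_1[OF z] by auto
  obtain C where C: "C > 0" "\<And>n. norm (pochhammer a n / pochhammer c n) \<le> C * q ^ n"
    using pochhammer_ratio_geometric_bound[OF c q(1), of a] by auto
  obtain D where D: "D > 0" "\<And>n. norm (pochhammer b n / fact n) \<le> D * q ^ n"
    using pochhammer_over_fact_geometric_bound[OF q(1), of b] by auto
  have majorant: "summable (\<lambda>n. (C * D) * (q ^ 2 * norm z) ^ n)"
    using q(2) by (intro summable_mult summable_geometric) (simp add: abs_mult)
  have bound: "norm (pochhammer a n * pochhammer b n / pochhammer c n * (z ^ n / fact n))
     \<le> (C * D) * (q ^ 2 * norm z) ^ n" for n
  proof -
    have "norm (pochhammer a n * pochhammer b n / pochhammer c n * (z ^ n / fact n))
       = norm (pochhammer a n / pochhammer c n) * norm (pochhammer b n / fact n) * norm z ^ n"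
      by (simp add: norm_mult norm_divide norm_power)
    also have "\<dots> \<le> (C * q ^ n) * (D * q ^ n) * norm z ^ n"
      using C(1) D(1) q(1) by (intro mult_right_mono mult_mono C(2) D(2)) simp_all
    also have "\<dots> = (C * D) * (q ^ 2 * norm z) ^ n"
      by (simp add: power_mult_distrib power2_eq_square)
    finally show ?thesis .
  qed
  show ?thesis
    by (rule summable_comparison_test'[OF majorant, where N = 0]) (simp only: real_norm_def abs_norm_cancel bound)
qed

lemmas hyp2F1_sums = summable_sums[OF summable_norm_cancel[OF hyp2F1_abs_summable], folded hyp2F1_def]

text \<open>Gauss's contiguous relation between \<open>A - 1\<close>, \<open>A\<close> and \<open>A + 1\<close>. Comparing coefficients of
  \<open>z ^ Suc n\<close>, all five contributions are multiples of the common factor \<open>P\<close>, and what remains is a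
  polynomial identity in \<open>A\<close>, \<open>B\<close>, \<open>c\<close> and \<open>n\<close>.\<close>

lemma hyp2F1_contiguous:
  assumes c: "c \<notin> \<int>\<^sub>\<le>\<^sub>0" and z: "norm z < 1"
  shows "(c - A) * hyp2F1 (A - 1) B c z + (2 * A - c + (B - A) * z) * hyp2F1 A B c z
           + A * (z - 1) * hyp2F1 (A + 1) B c z = 0"
proof -
  define u where "u A m = pochhammer A m * pochhammer B m / pochhammer c m * (z ^ m / fact m)" for A m
  have S: "u A sums hyp2F1 A B c z" for A
    unfolding u_def by (rule hyp2F1_sums[OF c z])
  \<comment> \<open>The coefficients of the series multiplied by \<open>z\<close>.\<close>
  define v where "v A m = (case m of 0 \<Rightarrow> 0 | Suc m' \<Rightarrow> z * u A m')" for A m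
  have V: "v A sums (z * hyp2F1 A B c z)" for A
  proof -
    have "(\<lambda>m. v A (Suc m)) sums (z * hyp2F1 A B c z)"
      unfolding v_def nat.case by (rule sums_mult[OF S])
    then have "v A sums (z * hyp2F1 A B c z + v A 0)"
      by (rule sums_Suc)
    then show ?thesis by (simp only: v_def nat.case add_0_right)
  qed
  have "(\<lambda>m. (c - A) * u (A - 1) m + (2 * A - c) * u A m + (B - A) * v A m + A * v (A + 1) m - A * u (A + 1) m)
     sums ((c - A) * hyp2F1 (A - 1) B c z + (2 * A - c) * hyp2F1 A B c z + (B - A) * (z * hyp2F1 A B c z)
        + A * (z * hyp2F1 (A + 1) B c z) - A * hyp2F1 (A + 1) B c z)"
    by (intro sums_add sums_diff sums_mult S V)
  moreover have "(c - A) * u (A - 1) m + (2 * A - c) * u A m + (B - A) * v A m + A * v (A + 1) m - A * u (A + 1) m = 0" for m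
  proof (cases m)
    case 0
    then show ?thesis by (simp add: u_def v_def)
  next
    case (Suc n)
    have cn: "pochhammer c n \<noteq> 0" "c + of_nat n \<noteq> 0"
      using pochhammer_nonzero[OF c, of n] pochhammer_nonzero[OF c, of "Suc n"]
      by (simp_all add: pochhammer_Suc)
    define P where "P = pochhammer A n * pochhammer B n / pochhammer c (Suc n) * (z ^ Suc n / fact (Suc n))"
    define N where "N = (of_nat n :: complex)"
    have a1: "pochhammer (A - 1) (Suc n) = (A - 1) * pochhammer A n"
      by (simp add: pochhammer_rec)
    have a2: "A * pochhammer (A + 1) k = (A + of_nat k) * pochhammer A k" for k
      by (metis pochhammer_Suc pochhammer_rec mult.commute)
    have 1: "u (A - 1) (Suc n) = (A - 1) * (B + N) * P"
      unfolding u_def P_def a1 N_def by (simp add: pochhammer_Suc)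
    have 2: "u A (Suc n) = (A + N) * (B + N) * P"
      unfolding u_def P_def N_def by (simp add: pochhammer_Suc)
    have 3: "v A (Suc n) = (N + 1) * (c + N) * P"
    proof -
      have "N + 1 \<noteq> 0"
        unfolding N_def by (metis of_nat_Suc add.commute of_nat_neq_0)
      moreover have "c + N \<noteq> 0" using cn by (simp add: N_def)
      ultimately have cancel: "z * (X / C * (Z / F)) = (N + 1) * (c + N) * (X / (C * (c + N)) * (z * Z / ((N + 1) * F)))" for X C Z F
        by simp
      have "fact (Suc n) = (N + 1) * fact n" by (simp add: N_def)
      then show ?thesis
        unfolding P_def v_def u_def nat.case pochhammer_Suc[of c] power_Suc N_def[symmetric]
        by (simp only: cancel)
    qed
    have 4: "A * v (A + 1) (Suc n) = (A + N) * (N + 1) * (c + N) * P"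
    proof -
      have "A * v (A + 1) (Suc n) = z * (A * pochhammer (A + 1) n) * pochhammer B n / pochhammer c n * (z ^ n / fact n)"
        unfolding v_def u_def by simp
      also have "\<dots> = (A + N) * (v A (Suc n))"
        unfolding a2 v_def u_def N_def by simp
      finally show ?thesis unfolding 3 by simp
    qed
    have 5: "A * u (A + 1) (Suc n) = (A + N) * (A + N + 1) * (B + N) * P"
    proof -
      have "A * u (A + 1) (Suc n) = (A * pochhammer (A + 1) (Suc n)) * pochhammer B (Suc n) / pochhammer c (Suc n) * (z ^ Suc n / fact (Suc n))"
        unfolding u_def by simp
      also have "\<dots> = (A + N + 1) * u A (Suc n)"
        unfolding a2 u_def N_def by (simp add: add_ac)
      finally show ?thesis unfolding 2 by (simp add: mult_ac)
    qed
    show ?thesis unfolding Suc 1 2 3 4 5 by (simp add: algebra_simps)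
  qed
  ultimately have "(c - A) * hyp2F1 (A - 1) B c z + (2 * A - c) * hyp2F1 A B c z + (B - A) * (z * hyp2F1 A B c z)
        + A * (z * hyp2F1 (A + 1) B c z) - A * hyp2F1 (A + 1) B c z = 0"
    using sums_unique2 sums_zero by (metis (no_types, lifting) sums_cong)
  then show ?thesis by (simp add: algebra_simps)
qed

text \<open>Read as a recurrence in \<open>n\<close> for the first parameter \<open>r - n\<close>, the contiguous relation has
  coefficients whose limits belong to the characteristic roots \<open>1\<close> and \<open>1 - z\<close>.\<close>

lemma hyp2F1_lowered_parameter_growth:
  assumes c: "c \<notin> \<int>\<^sub>\<le>\<^sub>0" and z: "norm z < 1" and q: "q > 1" "q > norm (1 - z)"
  shows "\<exists>C>0. \<forall>n. norm (hyp2F1 (r - of_nat n) B c z) \<le> C * q ^ n"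
proof -
  define h where "h n = hyp2F1 (r - of_nat n) B c z" for n
  define A where "A n = r - of_nat (Suc n)" for n :: nat
  define p where "p n = - (2 * A n - c + (B - A n) * z) / (c - A n)" for n
  define s where "s n = - (A n * (z - 1)) / (c - A n)" for n
  have inf: "filterlim (\<lambda>n. c - A n) at_infinity sequentially"
  proof -
    have "filterlim (\<lambda>n. (c - r + 1) + of_nat n) at_infinity sequentially"
      by (intro tendsto_add_filterlim_at_infinity[OF tendsto_const] tendsto_of_nat)
    then show ?thesis by (simp add: A_def algebra_simps)
  qed
  have nz: "eventually (\<lambda>n. c - A n \<noteq> 0) sequentially"
    using inf by (rule filterlim_at_infinity_imp_eventually_ne)
  have i0: "(\<lambda>n. inverse (c - A n)) \<longlonglongrightarrow> 0"
    by (rule filterlim_compose[OF tendsto_inverse_0 inf])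
  have "eventually (\<lambda>n. p n = 1 + (1 - z) + (c * z - B * z - c) * inverse (c - A n)) sequentially"
    using nz by eventually_elim (simp add: p_def field_simps)
  moreover have "(\<lambda>n. 1 + (1 - z) + (c * z - B * z - c) * inverse (c - A n)) \<longlonglongrightarrow> 1 + (1 - z) + (c * z - B * z - c) * 0"
    by (intro tendsto_intros i0)
  ultimately have p: "p \<longlonglongrightarrow> 1 + (1 - z)"
    by (simp add: filterlim_cong)
  have "eventually (\<lambda>n. s n = - (1 - z) + c * (1 - z) * inverse (c - A n)) sequentially"
    using nz by eventually_elim (simp add: s_def field_simps)
  moreover have "(\<lambda>n. - (1 - z) + c * (1 - z) * inverse (c - A n)) \<longlonglongrightarrow> - (1 - z) + c * (1 - z) * 0"
    by (intro tendsto_intros i0)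
  ultimately have s: "s \<longlonglongrightarrow> - (1 - z)"
    by (simp add: filterlim_cong)
  have "eventually (\<lambda>n. h (Suc (Suc n)) = p n * h (Suc n) + s n * h n) sequentially"
    using nz
  proof eventually_elim
    case (elim n)
    have "A n - 1 = r - of_nat (Suc (Suc n))" "A n + 1 = r - of_nat n" by (simp_all add: A_def)
    with hyp2F1_contiguous[OF c z, of "A n" B]
    have "(c - A n) * h (Suc (Suc n)) + (2 * A n - c + (B - A n) * z) * h (Suc n) + A n * (z - 1) * h n = 0"
      by (simp only: h_def A_def)
    then have "(c - A n) * h (Suc (Suc n)) = - (2 * A n - c + (B - A n) * z) * h (Suc n) - A n * (z - 1) * h n"
      by (simp add: algebra_simps add_eq_0_iff)
    then have "h (Suc (Suc n)) = (- (2 * A n - c + (B - A n) * z) * h (Suc n) - A n * (z - 1) * h n) / (c - A n)"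
      using elim by (metis nonzero_mult_div_cancel_left)
    then show ?case
      by (simp only: p_def s_def times_divide_eq_left add_divide_distrib mult_minus_left diff_conv_add_uminus)
  qed
  from second_order_recurrence_growth[OF this p s q] show ?thesis unfolding h_def .
qed

lemma hyp2F1_lowered_parameter_summable:
  assumes c: "c \<notin> \<int>\<^sub>\<le>\<^sub>0" and z: "norm z < 1" and T: "norm T < 1" "norm (T * (1 - z)) < 1"
  shows "summable (\<lambda>n. pochhammer l n / fact n * hyp2F1 (r - of_nat n) B c z * T ^ n)"
proof -
  define m where "m = max 1 (norm (1 - z))"
  have m: "m \<ge> 1" "m * norm T < 1"
    using T by (auto simp: m_def max_def norm_mult mult.commute)
  obtain q where q: "q > 1" "q ^ 2 * (m * norm T) < 1"
    using exists_square_factor_above_1[OF m(2)] by auto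
  have "q * m > m" using q m by simp
  then have qm: "q * m > 1" "q * m > norm (1 - z)"
    using m by (auto simp: m_def)
  obtain C where C: "C > 0" "\<And>n. norm (hyp2F1 (r - of_nat n) B c z) \<le> C * (q * m) ^ n"
    using hyp2F1_lowered_parameter_growth[OF c z qm, of r B] by auto
  obtain D where D: "D > 0" "\<And>n. norm (pochhammer l n / fact n) \<le> D * q ^ n"
    using pochhammer_over_fact_geometric_bound[OF q(1), of l] by auto
  have majorant: "summable (\<lambda>n. (D * C) * (q ^ 2 * (m * norm T)) ^ n)"
    using q(2) m(1) by (intro summable_mult summable_geometric) (simp only: real_norm_def abs_mult abs_power2 abs_norm_cancel abs_of_nonneg)
  have "norm (pochhammer l n / fact n * hyp2F1 (r - of_nat n) B c z * T ^ n)
      \<le> (D * C) * (q ^ 2 * (m * norm T)) ^ n" for n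
  proof -
    have "norm (pochhammer l n / fact n * hyp2F1 (r - of_nat n) B c z * T ^ n)
       = norm (pochhammer l n / fact n) * norm (hyp2F1 (r - of_nat n) B c z) * norm T ^ n"
      by (simp only: norm_mult norm_power)
    also have "\<dots> \<le> (D * q ^ n) * (C * (q * m) ^ n) * norm T ^ n"
      using C(1) D(1) q(1) m(1) by (intro mult_right_mono mult_mono C(2) D(2)) simp_all
    also have "\<dots> = (D * C) * (q ^ 2 * (m * norm T)) ^ n"
      by (simp add: power_mult_distrib power2_eq_square)
    finally show ?thesis .
  qed
  then show ?thesis
    by (rule summable_comparison_test'[OF majorant, where N = 0])
qed

section \<open>The first Appell series\<close>

definition appell_term ::
  "complex \<Rightarrow> complex \<Rightarrow> complex \<Rightarrow> complex \<Rightarrow> complex \<Rightarrow> complex \<Rightarrow> nat \<times> nat \<Rightarrow> complex" where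
  "appell_term a r l b X Y = (\<lambda>(i, j). pochhammer a (i + j) * pochhammer r i * pochhammer l j
     / pochhammer b (i + j) * (X ^ i / fact i) * (Y ^ j / fact j))"

definition appell_F1 ::
  "complex \<Rightarrow> complex \<Rightarrow> complex \<Rightarrow> complex \<Rightarrow> complex \<Rightarrow> complex \<Rightarrow> complex" where
  "appell_F1 a r l b X Y = infsum (appell_term a r l b X Y) UNIV"

lemma summable_on_product_nonneg:
  fixes f :: "'a \<Rightarrow> real" and g :: "'b \<Rightarrow> real"
  assumes f: "f summable_on UNIV" and g: "g summable_on UNIV"
    and nonneg: "\<And>x. f x \<ge> 0" "\<And>y. g y \<ge> 0"
  shows "(\<lambda>(x, y). f x * g y) summable_on UNIV"
proof -
  have "(\<lambda>(x, y). f x * g y) summable_on (UNIV \<times> UNIV)"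
  proof (rule summable_on_SigmaI)
    show "((\<lambda>y. (\<lambda>(x, y). f x * g y) (x, y)) has_sum (f x * infsum g UNIV)) UNIV" for x
      using g by (simp add: has_sum_cmult_right)
    show "(\<lambda>x. f x * infsum g UNIV) summable_on UNIV"
      by (rule summable_on_cmult_left[OF f])
  qed (use nonneg in auto)
  then show ?thesis by simp
qed

lemma summable_on_geometric:
  fixes x :: real
  assumes "0 \<le> x" "x < 1"
  shows "(\<lambda>n::nat. x ^ n) summable_on UNIV"
  using assms by (intro norm_summable_imp_summable_on) (simp add: norm_power summable_geometric)

lemma appell_term_summable:
  assumes b: "b \<notin> \<int>\<^sub>\<le>\<^sub>0" and X: "norm X < 1" and Y: "norm Y < 1"
  shows "appell_term a r l b X Y summable_on UNIV"
proof -
  have "max (norm X) (norm Y) < 1" using X Y by simp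
  from exists_square_factor_above_1[OF this]
  obtain q where q: "q > 1" "q ^ 2 * max (norm X) (norm Y) < 1" by auto
  have "q ^ 2 * norm X \<le> q ^ 2 * max (norm X) (norm Y)" "q ^ 2 * norm Y \<le> q ^ 2 * max (norm X) (norm Y)"
    using q(1) by (auto intro!: mult_left_mono)
  then have qXY: "q ^ 2 * norm X < 1" "q ^ 2 * norm Y < 1" using q(2) by auto
  obtain C where C: "C > 0" "\<And>n. norm (pochhammer a n / pochhammer b n) \<le> C * q ^ n"
    using pochhammer_ratio_geometric_bound[OF b q(1), of a] by auto
  obtain D where D: "D > 0" "\<And>n. norm (pochhammer r n / fact n) \<le> D * q ^ n"
    using pochhammer_over_fact_geometric_bound[OF q(1), of r] by auto
  obtain E where E: "E > 0" "\<And>n. norm (pochhammer l n / fact n) \<le> E * q ^ n"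
    using pochhammer_over_fact_geometric_bound[OF q(1), of l] by auto
  have majorant: "(\<lambda>(i, j). (C * D * E * (q ^ 2 * norm X) ^ i) * (q ^ 2 * norm Y) ^ j) summable_on UNIV"
    using C(1) D(1) E(1) q(1) qXY
    by (intro summable_on_product_nonneg summable_on_cmult_right summable_on_geometric) simp_all
  have "norm (appell_term a r l b X Y ij) \<le> (\<lambda>(i, j). (C * D * E * (q ^ 2 * norm X) ^ i) * (q ^ 2 * norm Y) ^ j) ij" for ij
  proof (cases ij)
    case (Pair i j)
    have "norm (appell_term a r l b X Y ij) =
        norm (pochhammer a (i + j) / pochhammer b (i + j)) * norm (pochhammer r i / fact i)
          * norm (pochhammer l j / fact j) * (norm X ^ i * norm Y ^ j)"
      by (simp add: Pair appell_term_def norm_mult norm_divide norm_power)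
    also have "\<dots> \<le> (C * q ^ (i + j)) * (D * q ^ i) * (E * q ^ j) * (norm X ^ i * norm Y ^ j)"
      using C(1) D(1) E(1) q(1) by (intro mult_right_mono mult_mono C(2) D(2) E(2)) simp_all
    also have "\<dots> = (C * D * E * (q ^ 2 * norm X) ^ i) * (q ^ 2 * norm Y) ^ j"
      by (simp add: power_mult_distrib power2_eq_square power_add)
    finally show ?thesis by (simp only: Pair case_prod_conv)
  qed
  from Infinite_Sum.abs_summable_on_comparison_test'[OF majorant this] show ?thesis
    by (rule abs_summable_summable)
qed

text \<open>Summing the rows of the double series first makes it a power series in \<open>Y\<close>; this is the
  source of its holomorphy in \<open>Y\<close>.\<close>

lemma appell_F1_power_series:
  assumes b: "b \<notin> \<int>\<^sub>\<le>\<^sub>0" and X: "norm X < 1"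
  obtains c where "\<And>Y. norm Y < 1 \<Longrightarrow> (\<lambda>j. c j * Y ^ j) sums appell_F1 a r l b X Y"
proof
  define c where "c j = (\<Sum>\<^sub>\<infinity>i. pochhammer a (i + j) * pochhammer r i * pochhammer l j
     / pochhammer b (i + j) * (X ^ i / fact i)) / fact j" for j
  fix Y :: complex
  assume Y: "norm Y < 1"
  have summable: "appell_term a r l b X Y summable_on (UNIV \<times> UNIV)"
    using appell_term_summable[OF b X Y] by simp
  have summable': "(\<lambda>(j, i). appell_term a r l b X Y (i, j)) summable_on (UNIV \<times> UNIV)"
    using summable by (subst (asm) summable_on_swap)
  have total: "((\<lambda>(j, i). appell_term a r l b X Y (i, j)) has_sum appell_F1 a r l b X Y) (UNIV \<times> UNIV)"
    using has_sum_infsum[OF summable] by (subst (asm) has_sum_swap) (simp add: appell_F1_def)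
  have "((\<lambda>i. appell_term a r l b X Y (i, j)) has_sum (c j * Y ^ j)) UNIV" for j
  proof -
    have "infsum (\<lambda>i. appell_term a r l b X Y (i, j)) UNIV = c j * Y ^ j"
    proof -
      define A where "A = (\<lambda>i. pochhammer a (i + j) * pochhammer r i * pochhammer l j
          / pochhammer b (i + j) * (X ^ i / fact i))"
      have "appell_term a r l b X Y (i, j) = A i * (Y ^ j / fact j)" for i
        by (simp only: appell_term_def A_def case_prod_conv)
      then have "infsum (\<lambda>i. appell_term a r l b X Y (i, j)) UNIV = infsum A UNIV * (Y ^ j / fact j)"
        by (simp only: infsum_cmult_left')
      moreover have "c j = infsum A UNIV / fact j"
        by (simp only: c_def A_def)
      ultimately show ?thesis by simp
    qed
    with summable_on_SigmaD1[OF summable', of j] show ?thesis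
      by (metis UNIV_I has_sum_infsum)
  qed
  from has_sum_SigmaD[OF total, of "\<lambda>j. c j * Y ^ j"] this
  show "(\<lambda>j. c j * Y ^ j) sums appell_F1 a r l b X Y"
    by (intro has_sum_imp_sums) simp
qed

section \<open>The generating function near the origin\<close>

lemma has_sum_binomial:
  fixes c T :: complex
  assumes "norm T < 1"
  shows "((\<lambda>n. pochhammer c n / fact n * T ^ n) has_sum (1 - T) powr (- c)) UNIV"
proof (rule norm_summable_imp_has_sum)
  have nz: "pochhammer 1 n \<noteq> (0 :: complex)" for n
    by (simp add: pochhammer_fact[symmetric])
  show "summable (\<lambda>n. norm (pochhammer c n / fact n * T ^ n))"
    using hyp2F1_abs_summable[OF one_notin_nonpos_Ints assms, of c 1] nz by simp
  have "(- c gchoose n) * (- T) ^ n = pochhammer c n / fact n * T ^ n" for n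
  proof -
    have "(- c gchoose n) * (- T) ^ n = ((- 1) ^ n * (- 1) ^ n) * (pochhammer c n / fact n * T ^ n)"
      by (simp only: gbinomial_pochhammer minus_minus power_minus[of T n]) simp
    then show ?thesis by (simp flip: power_mult_distrib)
  qed
  with gen_binomial_complex[of "- T" "- c"] assms
  show "(\<lambda>n. pochhammer c n / fact n * T ^ n) sums (1 - T) powr (- c)"
    by simp
qed

lemma pochhammer_neg_of_nat:
  "pochhammer (- of_nat (j + p)) j = ((- 1) ^ j * fact (j + p) / fact p :: complex)"
proof -
  define P where "P = pochhammer (- of_nat (j + p) :: complex) j"
  have "(of_nat (j + p) gchoose j) = (fact (j + p) / (fact j * fact p) :: complex)"
    by (subst binomial_gbinomial[symmetric]) (simp add: binomial_fact)
  then have "(- 1) ^ j * P = fact (j + p) / fact p"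
    unfolding gbinomial_pochhammer P_def[symmetric] by (simp add: field_simps)
  then have "(- 1) ^ j * ((- 1) ^ j * P) = (- 1) ^ j * (fact (j + p) / fact p)"
    by simp
  moreover have "(- 1) ^ j * ((- 1) ^ j * P) = P"
    by (simp flip: mult.assoc power_mult_distrib)
  ultimately show ?thesis by (simp add: P_def)
qed

text \<open>Both sides are rearrangements of one absolutely convergent triple series \<open>f\<close> over
  \<open>((i, j), p)\<close>. Summing over \<open>p\<close> is the binomial series with exponent \<open>- (l + j)\<close>; its value
  supplies the factor \<open>(1 - T) powr - l\<close> and turns \<open>X * T\<close> into \<open>X * T / (1 - T)\<close>, which leaves
  the Appell series. Grouping instead by \<open>n = j + p\<close> and then by \<open>m = i + j\<close> leaves a finite sum
  over \<open>j\<close>, which is the Vandermonde expansion of \<open>pochhammer (r - n) m\<close>, hence the Gauss series.\<close>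

lemma hyp2F1_appell_generating_function_small:
  assumes b: "b \<notin> \<int>\<^sub>\<le>\<^sub>0" and X: "norm X < 1" and T: "norm T < 1 / 8"
  shows "(\<lambda>n. pochhammer l n / fact n * hyp2F1 (r - of_nat n) a b X * T ^ n) sums
           ((1 - T) powr (- l) * appell_F1 a r l b X (- (X * T / (1 - T))))"
proof -
  define f where "f = (\<lambda>((i, j), p). pochhammer a (i + j) / pochhammer b (i + j) * (pochhammer r i / fact i * X ^ i)
       * (pochhammer l (j + p) / (fact j * fact p) * (- (X * T)) ^ j * T ^ p))"
  have summable: "f summable_on UNIV"
  proof -
    \<comment> \<open>The coefficients \<open>(j + p choose j)\<close> cost a factor \<open>2 ^ (j + p)\<close> and the Pochhammer bounds
      further powers of \<open>q\<close>. Since \<open>norm T < 1 / 8\<close>, these are harmless as soon as \<open>q ^ 2 < 2\<close>, which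
      is enforced by putting \<open>1 / 2\<close> into the maximum.\<close>
    have "max (norm X) (1 / 2) < 1" using X by simp
    from exists_square_factor_above_1[OF this]
    obtain q where q: "q > 1" "q ^ 2 * max (norm X) (1 / 2) < 1" by auto
    have "q ^ 2 * norm X \<le> q ^ 2 * max (norm X) (1 / 2)" "q ^ 2 * (1 / 2) \<le> q ^ 2 * max (norm X) (1 / 2)"
      using q(1) by (auto intro!: mult_left_mono)
    then have qX: "q ^ 2 * norm X < 1" and q2: "q ^ 2 < 2" using q(2) by auto
    have "q < q ^ 2" using q(1) by (simp add: power2_eq_square)
    then have "q < 2" using q2 by simp
    then have qT: "2 * q * norm T < 1"
      using T q(1) mult_strict_mono[of q 2 "norm T" "1 / 8"] by simp
    have "(q ^ 2 * norm X) * norm T < 1 * (1 / 8)"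
      using T qX q(1) by (intro mult_strict_mono) auto
    then have qXT: "2 * q ^ 2 * norm (X * T) < 1"
      by (simp add: norm_mult mult.assoc)
    obtain C where C: "C > 0" "\<And>n. norm (pochhammer a n / pochhammer b n) \<le> C * q ^ n"
      using pochhammer_ratio_geometric_bound[OF b q(1), of a] by auto
    obtain D where D: "D > 0" "\<And>n. norm (pochhammer r n / fact n) \<le> D * q ^ n"
      using pochhammer_over_fact_geometric_bound[OF q(1), of r] by auto
    obtain E where E: "E > 0" "\<And>n. norm (pochhammer l n / fact n) \<le> E * q ^ n"
      using pochhammer_over_fact_geometric_bound[OF q(1), of l] by auto
    define g where "g = (\<lambda>((i, j), p). ((C * D * E * (q ^ 2 * norm X) ^ i) * (2 * q ^ 2 * norm (X * T)) ^ j) * (2 * q * norm T) ^ p)"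
    have "(\<lambda>(ij, p). (\<lambda>(i, j). (C * D * E * (q ^ 2 * norm X) ^ i) * (2 * q ^ 2 * norm (X * T)) ^ j) ij
            * (2 * q * norm T) ^ p) summable_on UNIV"
      using C(1) D(1) E(1) q(1) qX qT qXT
      by (intro summable_on_product_nonneg summable_on_cmult_right summable_on_geometric) (auto simp: split_beta)
    then have majorant: "g summable_on UNIV"
      by (simp add: g_def case_prod_unfold)
    have "norm (f x) \<le> g x" for x
    proof -
      obtain i j p where x: "x = ((i, j), p)" by (metis surj_pair)
      have "(fact (j + p) / (fact j * fact p) :: real) = of_nat ((j + p) choose j)"
        by (simp add: binomial_fact)
      also have "\<dots> \<le> of_nat (2 ^ (j + p))"
        by (intro of_nat_mono binomial_le_pow2)
      finally have binom: "(fact (j + p) / (fact j * fact p) :: real) \<le> 2 ^ (j + p)" by simp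
      have "norm (pochhammer l (j + p) / (fact j * fact p))
              = norm (pochhammer l (j + p) / fact (j + p)) * (fact (j + p) / (fact j * fact p))"
        by (simp add: norm_mult norm_divide)
      also have "\<dots> \<le> (E * q ^ (j + p)) * 2 ^ (j + p)"
        using E(1) q(1) binom by (intro mult_mono E(2)) simp_all
      finally have lbound: "norm (pochhammer l (j + p) / (fact j * fact p)) \<le> (E * q ^ (j + p)) * 2 ^ (j + p)" .
      have "norm (f x) = norm (pochhammer a (i + j) / pochhammer b (i + j)) * norm (pochhammer r i / fact i)
          * norm (pochhammer l (j + p) / (fact j * fact p)) * (norm X ^ i * norm (X * T) ^ j * norm T ^ p)"
        by (simp add: x f_def norm_mult norm_divide norm_power mult_ac)
      also have "\<dots> \<le> (C * q ^ (i + j)) * (D * q ^ i) * ((E * q ^ (j + p)) * 2 ^ (j + p))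
          * (norm X ^ i * norm (X * T) ^ j * norm T ^ p)"
        using C(1) D(1) E(1) q(1) by (intro mult_right_mono mult_mono C(2) D(2) lbound) simp_all
      also have "\<dots> = g x"
        by (simp add: x g_def power_mult_distrib power2_eq_square power_add)
      finally show ?thesis .
    qed
    from Infinite_Sum.abs_summable_on_comparison_test'[OF majorant this] show ?thesis
      by (rule abs_summable_summable)
  qed
  define S where "S = infsum f UNIV"
  have f_sum: "(f has_sum S) UNIV"
    unfolding S_def by (rule has_sum_infsum[OF summable])

  define Y where "Y = - (X * T / (1 - T))"
  have T1: "norm T < 1" using T by simp
  then have T_neq: "1 - T \<noteq> 0" by auto
  have "((\<lambda>p. f (ij, p)) has_sum (appell_term a r l b X Y ij * (1 - T) powr (- l))) UNIV" for ij
  proof (cases ij)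
    case (Pair i j)
    define K where "K = pochhammer a (i + j) / pochhammer b (i + j) * (pochhammer r i / fact i * X ^ i)
        * (pochhammer l j / fact j * (- (X * T)) ^ j)"
    have "(1 - T) powr (- (l + of_nat j)) = (1 - T) powr (- l) * (1 - T) powr (- of_nat j)"
      by (simp flip: powr_add)
    also have "(1 - T) powr (- of_nat j) = 1 / (1 - T) ^ j"
      using T_neq by (simp add: powr_minus powr_nat' field_simps)
    finally have pw: "(1 - T) powr (- (l + of_nat j)) = (1 - T) powr (- l) * (1 / (1 - T) ^ j)" .
    have "((\<lambda>p. K * (pochhammer (l + of_nat j) p / fact p * T ^ p)) has_sum
             (K * (1 - T) powr (- (l + of_nat j)))) UNIV"
      by (intro has_sum_cmult_right has_sum_binomial T1)
    moreover have "K * (pochhammer (l + of_nat j) p / fact p * T ^ p) = f (ij, p)" for p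
      by (simp add: f_def K_def Pair pochhammer_product'[of l] mult_ac)
    moreover have "K * (1 - T) powr (- (l + of_nat j)) = appell_term a r l b X Y ij * (1 - T) powr (- l)"
    proof -
      have "Y ^ j = (- (X * T)) ^ j * (1 / (1 - T) ^ j)"
        unfolding Y_def minus_divide_left power_divide by simp
      then show ?thesis
        unfolding pw by (simp add: K_def Pair appell_term_def mult_ac)
    qed
    ultimately show ?thesis by simp
  qed
  moreover have "(f has_sum S) (UNIV \<times> UNIV)" using f_sum by simp
  ultimately have "((\<lambda>ij. appell_term a r l b X Y ij * (1 - T) powr (- l)) has_sum S) UNIV"
    by (rule has_sum_SigmaD[rotated])
  then have "S = infsum (\<lambda>ij. appell_term a r l b X Y ij * (1 - T) powr (- l)) UNIV"
    by (rule infsumI[symmetric])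
  then have S_eq: "S = (1 - T) powr (- l) * appell_F1 a r l b X Y"
    by (simp add: appell_F1_def infsum_cmult_left')

  \<comment> \<open>The same terms indexed by \<open>n = j + p\<close>. The factor \<open>pochhammer (- n) j\<close> vanishes for \<open>j > n\<close>, so
    the index range may be extended to all triples.\<close>
  define F where "F = (\<lambda>(n, (i, j)). (pochhammer l n / fact n * T ^ n) *
       (pochhammer a (i + j) * pochhammer r i / pochhammer b (i + j) * X ^ (i + j) / (fact i * fact j)
         * pochhammer (- of_nat n) j))"
  have "(F has_sum S) {(n, (i, j)) | n i j. j \<le> n}"
  proof -
    have "F (j + p, (i, j)) = f ((i, j), p)" for i j p
      unfolding F_def f_def case_prod_conv pochhammer_neg_of_nat power_add power_minus[of "X * T" j] power_mult_distrib
      by (simp add: mult_ac)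
    then show ?thesis
      using f_sum
      by (subst (asm) has_sum_reindex_bij_witness[where T = "{(n, (i, j)) | n i j. j \<le> n}" and h = F and s' = S
            and j = "\<lambda>((i, j), p). (j + p, (i, j))" and i = "\<lambda>(n, (i, j)). ((i, j), n - j)"]) auto
  qed
  moreover have "F x = 0" if "x \<notin> {(n, (i, j)) | n i j. j \<le> n}" for x
    using that by (cases x) (auto simp: F_def pochhammer_of_nat_eq_0_lemma)
  ultimately have F_sum: "(F has_sum S) (UNIV \<times> UNIV)"
    by (subst has_sum_cong_neutral[where T = "{(n, (i, j)) | n i j. j \<le> n}" and g = F]) auto
  have section_sum: "((\<lambda>ij. F (n, ij)) has_sum
      (pochhammer l n / fact n * hyp2F1 (r - of_nat n) a b X * T ^ n)) UNIV" for n
  proof -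
    define w where "w = infsum (\<lambda>ij. F (n, ij)) UNIV"
    have "(\<lambda>(n, ij). F (n, ij)) summable_on (UNIV \<times> UNIV)"
      using F_sum by (simp add: has_sum_imp_summable)
    from summable_on_SigmaD1[OF this, of n] have w: "((\<lambda>ij. F (n, ij)) has_sum w) UNIV"
      unfolding w_def by (intro has_sum_infsum) simp
    define G where "G = (\<lambda>(m, j). F (n, (m - j, j)))"
    have "(G has_sum w) (SIGMA m:UNIV. {..m})"
      using w
      by (subst (asm) has_sum_reindex_bij_witness[where T = "SIGMA m:UNIV. {..m}" and h = G and s' = w
            and j = "\<lambda>(i, j). (i + j, j)" and i = "\<lambda>(m, j). (m - j, j)"]) (auto simp: G_def)
    moreover have "((\<lambda>j. G (m, j)) has_sum (\<Sum>j\<le>m. G (m, j))) {..m}" for m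
      by (rule has_sum_finite) simp
    ultimately have "((\<lambda>m. \<Sum>j\<le>m. G (m, j)) has_sum w) UNIV"
      by (rule has_sum_SigmaD)
    then have sums_w: "(\<lambda>m. \<Sum>j\<le>m. G (m, j)) sums w"
      by (rule has_sum_imp_sums)
    have "(\<Sum>j\<le>m. G (m, j)) = (pochhammer l n / fact n * T ^ n) *
             (pochhammer (r - of_nat n) m * pochhammer a m / pochhammer b m * (X ^ m / fact m))" for m
    proof -
      have "(\<Sum>j\<le>m. G (m, j)) = (\<Sum>j\<le>m. (pochhammer l n / fact n * T ^ n) *
             (pochhammer a m / pochhammer b m * (X ^ m / fact m)) *
             (of_nat (m choose j) * pochhammer (- of_nat n) j * pochhammer r (m - j)))"
        by (intro sum.cong refl) (simp add: G_def F_def binomial_fact mult_ac)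
      also have "\<dots> = (pochhammer l n / fact n * T ^ n) *
             (pochhammer a m / pochhammer b m * (X ^ m / fact m)) * pochhammer (- of_nat n + r) m"
        by (simp only: pochhammer_binomial_sum sum_distrib_left)
      finally show ?thesis by simp
    qed
    moreover have "(\<lambda>m. (pochhammer l n / fact n * T ^ n) *
             (pochhammer (r - of_nat n) m * pochhammer a m / pochhammer b m * (X ^ m / fact m)))
          sums ((pochhammer l n / fact n * T ^ n) * hyp2F1 (r - of_nat n) a b X)"
      by (intro sums_mult hyp2F1_sums b X)
    ultimately have "w = (pochhammer l n / fact n * T ^ n) * hyp2F1 (r - of_nat n) a b X"
      using sums_w sums_unique2 by simp
    with w show ?thesis by (simp add: mult_ac)
  qed
  have "((\<lambda>n. pochhammer l n / fact n * hyp2F1 (r - of_nat n) a b X * T ^ n) has_sum S) UNIV"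
    by (rule has_sum_SigmaD[OF F_sum]) (rule section_sum)
  from has_sum_imp_sums[OF this] show ?thesis
    unfolding S_eq Y_def .
qed

section \<open>Abel's limit theorem\<close>

text \<open>Summation by parts turns the power series minus \<open>S\<close> into \<open>(1 - s)\<close> times the power series of
  the deviations \<open>\<rho> (n + 1)\<close> of the partial sums from \<open>S\<close>. These tend to 0, so only finitely many of
  them are not small, and those are killed by the factor \<open>1 - s\<close>.\<close>

lemma Abel_limit_radial:
  fixes a :: "nat \<Rightarrow> complex"
  assumes "a sums S"
  shows "((\<lambda>s::real. \<Sum>n. a n * of_real s ^ n) \<longlongrightarrow> S) (at_left 1)"
proof -
  define \<rho> where "\<rho> n = (\<Sum>k<n. a k) - S" for n
  have \<rho>0: "\<rho> \<longlonglongrightarrow> 0"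
    using assms unfolding \<rho>_def sums_def by (rule LIM_zero)
  obtain M where M: "\<And>n. norm (\<rho> n) \<le> M"
    using \<rho>0 convergentI convergent_imp_Bseq by (metis BseqE)
  have summ: "summable (\<lambda>n. norm (\<rho> (Suc n)) * s ^ n)" if "0 < s" "s < 1" for s :: real
  proof (rule summable_comparison_test'[where N = 0])
    show "summable (\<lambda>n. M * s ^ n)"
      using that by (intro summable_mult summable_geometric) simp
    show "norm (norm (\<rho> (Suc n)) * s ^ n) \<le> M * s ^ n" for n
      using that M by (simp add: abs_mult mult_right_mono)
  qed
  have tail: "norm ((\<Sum>n. a n * of_real s ^ n) - S) \<le> (1 - s) * (\<Sum>n. norm (\<rho> (Suc n)) * s ^ n)"
    if s: "0 < s" "s < 1" for s :: real
  proof -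
    define R where "R = (\<Sum>n. \<rho> (Suc n) * of_real s ^ n)"
    have sn: "summable (\<lambda>n. norm (\<rho> (Suc n) * of_real s ^ n))"
      using summ[OF s] s by (simp add: norm_mult norm_power)
    have R: "(\<lambda>n. \<rho> (Suc n) * of_real s ^ n) sums R"
      unfolding R_def by (rule summable_sums[OF summable_norm_cancel[OF sn]])
    have "(\<lambda>n. of_real s * (\<rho> (Suc n) * of_real s ^ n)) sums (of_real s * R)"
      by (rule sums_mult[OF R])
    then have "(\<lambda>n. \<rho> (Suc n) * of_real s ^ Suc n) sums (of_real s * R)"
      by (simp add: mult.left_commute)
    then have "(\<lambda>n. \<rho> n * of_real s ^ n) sums (of_real s * R + \<rho> 0 * of_real s ^ 0)"
      by (rule sums_Suc)
    from sums_diff[OF R this]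
    have "(\<lambda>n. (\<rho> (Suc n) - \<rho> n) * of_real s ^ n) sums (R - (of_real s * R + \<rho> 0 * of_real s ^ 0))"
      by (simp only: left_diff_distrib)
    moreover have "\<rho> (Suc n) - \<rho> n = a n" for n
      by (simp add: \<rho>_def)
    ultimately have "(\<Sum>n. a n * of_real s ^ n) = R - (of_real s * R + \<rho> 0 * of_real s ^ 0)"
      by (simp add: sums_iff)
    then have "(\<Sum>n. a n * of_real s ^ n) - S = (1 - of_real s) * R"
      by (simp add: \<rho>_def algebra_simps)
    also have "\<dots> = of_real (1 - s) * R" by simp
    also have "norm \<dots> = (1 - s) * norm R"
      unfolding norm_mult norm_of_real using s by simp
    also have "\<dots> \<le> (1 - s) * (\<Sum>n. norm (\<rho> (Suc n)) * s ^ n)"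
      using summable_norm[OF sn] s unfolding R_def
      by (intro mult_left_mono) (auto simp: norm_mult norm_power)
    finally show ?thesis .
  qed
  show ?thesis
  proof (rule tendstoI)
    fix e :: real
    assume e: "e > 0"
    obtain N where N: "\<And>n. n \<ge> N \<Longrightarrow> norm (\<rho> n) < e / 2"
      using LIMSEQ_D[OF \<rho>0, of "e / 2"] e by auto
    define K where "K = (\<Sum>n<N. norm (\<rho> (Suc n)))"
    have bound: "(1 - s) * (\<Sum>n. norm (\<rho> (Suc n)) * s ^ n) \<le> (1 - s) * K + e / 2"
      if s: "0 < s" "s < 1" for s :: real
    proof -
      have termwise: "norm (\<rho> (Suc n)) * s ^ n \<le> (if n < N then norm (\<rho> (Suc n)) else 0) + (e / 2) * s ^ n" for n
      proof (cases "n < N")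
        case True
        have "norm (\<rho> (Suc n)) * s ^ n \<le> norm (\<rho> (Suc n)) * 1"
          using s by (intro mult_left_mono) (auto simp: power_le_one)
        moreover have "(e / 2) * s ^ n \<ge> 0" using e s by simp
        ultimately show ?thesis using True by simp
      next
        case False
        with N[of "Suc n"] s show ?thesis by (auto intro!: mult_right_mono)
      qed
      have "(\<lambda>n. if n < N then norm (\<rho> (Suc n)) else 0) sums K"
        unfolding K_def using sums_If_finite[of "\<lambda>n. n < N" "\<lambda>n. norm (\<rho> (Suc n))"] by (simp add: lessThan_def)
      moreover have "(\<lambda>n. (e / 2) * s ^ n) sums ((e / 2) * (1 / (1 - s)))"
        using s by (intro sums_mult geometric_sums) simp
      ultimately have "(\<lambda>n. (if n < N then norm (\<rho> (Suc n)) else 0) + (e / 2) * s ^ n) sums (K + (e / 2) * (1 / (1 - s)))"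
        by (rule sums_add)
      then have "(\<Sum>n. norm (\<rho> (Suc n)) * s ^ n) \<le> K + (e / 2) * (1 / (1 - s))"
        by (rule sums_le[OF termwise summable_sums[OF summ[OF s]]])
      then have "(1 - s) * (\<Sum>n. norm (\<rho> (Suc n)) * s ^ n) \<le> (1 - s) * (K + (e / 2) * (1 / (1 - s)))"
        using s by (intro mult_left_mono) auto
      also have "\<dots> = (1 - s) * K + e / 2" using s by (simp add: field_simps)
      finally show ?thesis .
    qed
    have "((\<lambda>s. (1 - s) * K + e / 2) \<longlongrightarrow> (1 - 1) * K + e / 2) (at_left 1)"
      by (intro tendsto_intros)
    from order_tendstoD(2)[OF this, of e]
    have "eventually (\<lambda>s. (1 - s) * K + e / 2 < e) (at_left 1)"
      using e by simp
    moreover have "eventually (\<lambda>s::real. 0 < s \<and> s < 1) (at_left 1)"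
      using eventually_at_left_real[of 0 "1::real"] by simp
    ultimately show "eventually (\<lambda>s. dist (\<Sum>n. a n * of_real s ^ n) S < e) (at_left 1)"
    proof eventually_elim
      case (elim s)
      with tail[of s] bound[of s] show ?case by (auto simp: dist_norm)
    qed
  qed
qed

section \<open>The domain of continuation\<close>

text \<open>For \<open>0 \<le> k < 1\<close> the first condition removes a closed disc around a point of the positive axis that
  contains 1 (a disc of Apollonius for the points 0 and 1), the second one the ray from 1 to
  infinity on which the principal branch of \<open>(1 - T) powr c\<close> jumps.\<close>

definition slit_exterior :: "real \<Rightarrow> complex set" where
  "slit_exterior k = {T. k * norm T < norm (1 - T) \<and> 1 - T \<notin> \<real>\<^sub>\<le>\<^sub>0}"

lemma open_slit_exterior: "open (slit_exterior k)"
proof -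
  have "slit_exterior k = {T. k * norm T < norm (1 - T)} \<inter> ((\<lambda>T. 1 - T) -` (- \<real>\<^sub>\<le>\<^sub>0))"
    by (auto simp: slit_exterior_def)
  moreover have "open {T :: complex. k * norm T < norm (1 - T)}"
    by (intro open_Collect_less continuous_intros)
  moreover have "open ((\<lambda>T :: complex. 1 - T) -` (- \<real>\<^sub>\<le>\<^sub>0))"
    by (intro open_vimage continuous_intros) (simp add: closed_nonpos_Reals_complex open_Compl)
  ultimately show ?thesis by auto
qed

lemma norm_one_minus_rcis: "norm (1 - rcis r u) ^ 2 = 1 + r ^ 2 - 2 * r * cos u"
proof -
  have "norm (1 - rcis r u) ^ 2 = (1 - r * cos u) ^ 2 + (r * sin u) ^ 2"
    by (simp add: cmod_power2)
  also have "\<dots> = 1 + r ^ 2 * (cos u ^ 2 + sin u ^ 2) - 2 * r * cos u"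
    unfolding power2_diff power_mult_distrib distrib_left by simp
  finally show ?thesis by simp
qed

text \<open>On a circle around 0, membership depends only on the cosine of the angle, because the distance
  to 1 increases as the point turns away from the positive axis.\<close>

lemma rcis_mem_slit_exterior_mono:
  assumes k: "0 \<le> k" and r: "r > 0"
    and u: "rcis r u \<in> slit_exterior k" and v: "cos v \<le> cos u" "cos v < 1"
  shows "rcis r v \<in> slit_exterior k"
proof -
  have "norm (1 - rcis r u) ^ 2 \<le> norm (1 - rcis r v) ^ 2"
    unfolding norm_one_minus_rcis using v r by simp
  then have "norm (1 - rcis r u) \<le> norm (1 - rcis r v)"
    by (rule power2_le_imp_le) simp
  moreover have "1 - rcis r v \<notin> \<real>\<^sub>\<le>\<^sub>0"
  proof
    assume "1 - rcis r v \<in> \<real>\<^sub>\<le>\<^sub>0"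
    then have "1 \<le> r * cos v" "r * sin v = 0" by (auto simp: complex_nonpos_Reals_iff)
    then have "0 < r * cos v" "sin v = 0" using r by auto
    then have "sin v = 0" "cos v > 0" using r by (auto simp: zero_less_mult_iff)
    then show False using v(2) sin_zero_abs_cos_one by force
  qed
  ultimately show ?thesis using u r by (auto simp: slit_exterior_def)
qed

lemma negative_real_mem_slit_exterior:
  assumes k: "0 \<le> k" "k < 1" and s: "0 \<le> s"
  shows "- complex_of_real s \<in> slit_exterior k"
proof -
  have "k * s \<le> s" using k s mult_right_mono[of k 1 s] by simp
  moreover have "norm (1 + complex_of_real s) = 1 + s"
    using s by (metis abs_of_nonneg add_nonneg_nonneg norm_of_real of_real_1 of_real_add zero_le_one)
  ultimately show ?thesis using s by (auto simp: slit_exterior_def complex_nonpos_Reals_iff)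
qed

text \<open>The set is not star-shaped about 0, since the removed disc casts a shadow. A non-real point can
  however be turned along its circle, away from the positive axis, until it reaches the negative
  axis, and then be moved straight to 0; a real point can be moved to 0 directly.\<close>

lemma connected_disc_Int_slit_exterior:
  assumes k: "0 \<le> k" "k < 1" and "R > 0"
  shows "connected (ball 0 R \<inter> slit_exterior k)"
proof -
  let ?S = "ball 0 R \<inter> slit_exterior k"
  have "\<exists>C. connected C \<and> T \<in> C \<and> 0 \<in> C \<and> C \<subseteq> ?S" if T: "T \<in> ?S" for T
  proof (cases "T \<in> \<real>")
    case True
    then obtain t where t: "T = of_real t" by (auto elim: Reals_cases)
    have real_mem: "of_real v \<in> ?S \<longleftrightarrow> v < 1 \<and> \<bar>v\<bar> < R \<and> k * \<bar>v\<bar> < 1 - v" for v :: real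
    proof -
      have "norm (1 - complex_of_real v) = \<bar>1 - v\<bar>"
        by (metis norm_of_real of_real_1 of_real_diff)
      then show ?thesis
        by (auto simp: slit_exterior_def complex_nonpos_Reals_iff)
    qed
    have t1: "t < 1" "\<bar>t\<bar> < R" "k * \<bar>t\<bar> < 1 - t"
      using T real_mem[of t] unfolding t by blast+
    have "closed_segment 0 T \<subseteq> ?S"
    proof
      fix z assume "z \<in> closed_segment 0 T"
      then obtain u where u: "0 \<le> u" "u \<le> 1" and "z = (1 - u) *\<^sub>R 0 + u *\<^sub>R T"
        by (auto simp: closed_segment_def)
      then have z: "z = of_real (u * t)"
        by (simp add: t scaleR_conv_of_real)
      have "\<bar>u * t\<bar> \<le> \<bar>t\<bar>" using u by (simp add: abs_mult mult_left_le_one_le)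
      moreover have "u * t < 1"
        using u t1 by (smt (verit) mult_left_le_one_le mult_nonneg_nonpos)
      moreover have "k * \<bar>u * t\<bar> < 1 - u * t"
      proof -
        have "u * (k * \<bar>t\<bar> + t) < 1"
          using u t1 by (smt (verit) mult_left_le_one_le mult_nonneg_nonpos)
        then show ?thesis using u by (simp add: abs_mult algebra_simps)
      qed
      ultimately show "z \<in> ?S"
        using t1 unfolding z real_mem by auto
    qed
    then show ?thesis by (intro exI[of _ "closed_segment 0 T"]) auto
  next
    case False
    define r \<theta> where "r = norm T" and "\<theta> = Arg T"
    have T_polar: "T = rcis r \<theta>" by (simp add: r_def \<theta>_def rcis_cmod_Arg)
    have "T \<noteq> 0" using False by auto
    then have r: "r > 0" "r < R" using T by (auto simp: r_def)
    have "\<theta> \<noteq> 0"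
    proof
      assume "\<theta> = 0"
      then have "T = of_real r" using T_polar by (simp only: rcis_zero_arg)
      then show False using False by simp
    qed
    then have \<theta>: "- pi < \<theta>" "\<theta> \<le> pi" "\<theta> \<noteq> 0"
      using Arg_bounded[of T] by (simp_all add: \<theta>_def)
    define A where "A = (\<lambda>u. rcis r (sgn \<theta> * u)) ` {\<bar>\<theta>\<bar>..pi}"
    have "connected A"
      unfolding A_def by (intro connected_continuous_image continuous_intros) auto
    moreover have "T \<in> A"
      unfolding A_def using \<theta> by (intro image_eqI[of _ _ "\<bar>\<theta>\<bar>"]) (auto simp: T_polar sgn_mult_abs)
    moreover have endpoint: "- of_real r \<in> A"
      unfolding A_def using \<theta> by (intro image_eqI[of _ _ pi]) (auto simp: rcis_def sgn_if cis_cnj[symmetric])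
    moreover have "A \<subseteq> ?S"
    proof
      fix z assume "z \<in> A"
      then obtain u where u: "\<bar>\<theta>\<bar> \<le> u" "u \<le> pi" "z = rcis r (sgn \<theta> * u)" by (auto simp: A_def)
      have cu: "cos (sgn \<theta> * u) = cos u" using \<theta>(3) by (auto simp: sgn_if)
      have "cos u \<le> cos \<bar>\<theta>\<bar>" using u by (intro cos_monotone_0_pi_le) auto
      then have le: "cos (sgn \<theta> * u) \<le> cos \<theta>" unfolding cu by simp
      have "cos u < cos 0" using u \<theta> by (intro cos_monotone_0_pi) auto
      then have less: "cos (sgn \<theta> * u) < 1" unfolding cu by simp
      have "rcis r \<theta> \<in> slit_exterior k"
        using T unfolding T_polar[symmetric] by (rule IntD2)
      from rcis_mem_slit_exterior_mono[OF k(1) r(1) this le less]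
      have "z \<in> slit_exterior k" unfolding u(3) .
      then show "z \<in> ?S" using r u(3) by simp
    qed
    moreover have "closed_segment 0 (- of_real r) \<subseteq> ?S"
    proof
      fix z assume "z \<in> closed_segment 0 (- of_real r :: complex)"
      then obtain u where u: "0 \<le> u" "u \<le> 1" "z = - of_real (u * r)"
        by (auto simp: closed_segment_def scaleR_conv_of_real)
      have "u * r \<le> r" using u r by (simp add: mult_left_le_one_le)
      moreover have "norm z = u * r" unfolding u(3) norm_minus_cancel norm_of_real using u r by simp
      ultimately have "norm z < R" using r(2) by linarith
      moreover have "z \<in> slit_exterior k"
        unfolding u(3) using u r by (intro negative_real_mem_slit_exterior k) simp
      ultimately show "z \<in> ?S" by simp
    qed
    moreover have "connected (A \<union> closed_segment 0 (- of_real r))"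
      using \<open>connected A\<close> endpoint by (intro connected_Un) auto
    ultimately show ?thesis by (intro exI[of _ "A \<union> closed_segment 0 (- of_real r)"]) auto
  qed
  then obtain C where C: "\<And>T. T \<in> ?S \<Longrightarrow> connected (C T) \<and> T \<in> C T \<and> 0 \<in> C T \<and> C T \<subseteq> ?S"
    by metis
  have "?S = (\<Union>T\<in>?S. C T)" using C by fast
  moreover have "connected (\<Union>T\<in>?S. C T)"
  proof (rule connected_Union)
    have "0 \<in> \<Inter> (C ` ?S)" using C by blast
    then show "\<Inter> (C ` ?S) \<noteq> {}" by blast
  qed (use C in blast)
  ultimately show ?thesis by metis
qed

text \<open>The principal logarithm assigns the argument \<open>\<pi>\<close> to negative reals, so that it is continuous
  from the closed upper half plane. Turning \<open>1 - w\<close> by \<open>- \<i>\<close> moves that half plane into the region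
  where the logarithm is continuous.\<close>

lemma continuous_one_minus_powr_lower_half_plane:
  fixes z c :: complex
  assumes "z \<noteq> 1" "Im z \<le> 0"
  shows "continuous (at z within {w. Im w \<le> 0}) (\<lambda>w. (1 - w) powr c)"
proof -
  let ?g = "\<lambda>w. exp (c * (Ln (- \<i> * (1 - w)) + \<i> * of_real pi / 2))"
  have eq: "(1 - w) powr c = ?g w" if "w \<noteq> 1" "Im w \<le> 0" for w
    using Ln_times_ii[of "- \<i> * (1 - w)"] that by (simp add: powr_def)
  have "- \<i> * (1 - z) \<notin> \<real>\<^sub>\<le>\<^sub>0"
    using assms by (auto simp: complex_nonpos_Reals_iff complex_eq_iff)
  then have "isCont ?g z"
    by (intro continuous_intros)
  then have "(?g \<longlongrightarrow> ?g z) (at z within {w. Im w \<le> 0})"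
    using continuous_at_imp_continuous_within continuous_within by blast
  moreover have "eventually (\<lambda>w. ?g w = (1 - w) powr c) (at z within {w. Im w \<le> 0})"
  proof -
    have "eventually (\<lambda>w. w \<noteq> 1) (at z within {w. Im w \<le> 0})"
      using assms(1) by (rule tendsto_imp_eventually_ne[OF tendsto_ident_at])
    moreover have "eventually (\<lambda>w. w \<in> {w. Im w \<le> 0}) (at z within {w. Im w \<le> 0})"
      by (simp add: eventually_at_filter)
    ultimately show ?thesis
      by eventually_elim (simp add: eq)
  qed
  ultimately show ?thesis
    unfolding continuous_within eq[OF assms] by (rule Lim_transform_eventually)
qed

section \<open>The generating function wherever the series converges\<close>

text \<open>Convergence at \<open>T\<close> makes the left-hand side \<open>L\<close> holomorphic on the disc of radius \<open>norm T\<close>, and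
  the right-hand side \<open>G\<close> is holomorphic on the slit exterior, so the identity spreads from a
  neighbourhood of 0 to their connected intersection. Two kinds of points are then reached by
  limits: points on the slit inside the disc from the lower half plane, because \<open>G\<close> takes there the
  boundary value from that side; and \<open>T\<close> itself, which may lie on the circle of convergence, along
  its radius by Abel's theorem.\<close>

theorem hyp2F1_appell_generating_function:
  assumes b: "b \<notin> \<int>\<^sub>\<le>\<^sub>0" and X: "norm X < 1" and T: "T \<noteq> 1" "norm (X * T / (1 - T)) < 1"
    and summable: "summable (\<lambda>n. pochhammer l n / fact n * hyp2F1 (r - of_nat n) a b X * T ^ n)"
  shows "(\<Sum>n. pochhammer l n / fact n * hyp2F1 (r - of_nat n) a b X * T ^ n) =
           (1 - T) powr (- l) * appell_F1 a r l b X (- (X * T / (1 - T)))"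
proof (cases "T = 0")
  case True
  then show ?thesis
    using hyp2F1_appell_generating_function_small[OF b X, of T l r a] by (simp add: sums_iff)
next
  case False
  define g where "g n = pochhammer l n / fact n * hyp2F1 (r - of_nat n) a b X" for n
  define L where "L z = (\<Sum>n. g n * z ^ n)" for z
  define Y where "Y z = - (X * z / (1 - z))" for z :: complex
  define G where "G z = (1 - z) powr (- l) * appell_F1 a r l b X (Y z)" for z
  define D where "D = {z :: complex. norm X * norm z < norm (1 - z)}"
  define R where "R = norm T"
  have R: "R > 0" using False by (simp add: R_def)
  have summable_T: "summable (\<lambda>n. g n * T ^ n)"
    using summable by (simp add: g_def)
  have D_neq: "z \<noteq> 1" and Y_ball: "Y z \<in> ball 0 1" if "z \<in> D" for z
  proof -
    show "z \<noteq> 1"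
    proof
      assume "z = 1"
      then have "norm X < 0" using that by (simp add: D_def)
      then show False by simp
    qed
    then show "Y z \<in> ball 0 1"
      using that by (simp add: Y_def D_def norm_mult norm_divide divide_less_eq)
  qed
  have open_D: "open D"
    unfolding D_def by (intro open_Collect_less continuous_intros)
  have T_D: "T \<in> D"
    using T by (simp add: D_def norm_mult norm_divide divide_less_eq)
  have slit: "slit_exterior (norm X) = {z \<in> D. 1 - z \<notin> \<real>\<^sub>\<le>\<^sub>0}"
    by (auto simp: slit_exterior_def D_def)

  have F_hol: "appell_F1 a r l b X holomorphic_on ball 0 1"
  proof -
    obtain c where c: "\<And>Y. norm Y < 1 \<Longrightarrow> (\<lambda>j. c j * Y ^ j) sums appell_F1 a r l b X Y"
      using appell_F1_power_series[OF b X] by metis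
    show ?thesis
      by (rule power_series_holomorphic[where a = c]) (simp add: c)
  qed
  have FY_hol: "(\<lambda>z. appell_F1 a r l b X (Y z)) holomorphic_on D"
  proof -
    have "Y holomorphic_on D"
      unfolding Y_def using D_neq by (intro holomorphic_intros) auto
    moreover have "Y ` D \<subseteq> ball 0 1" using Y_ball by blast
    ultimately show ?thesis
      using holomorphic_on_compose_gen[OF _ F_hol, of Y D] by (simp add: o_def)
  qed
  have G_hol: "G holomorphic_on slit_exterior (norm X)"
    unfolding G_def
    by (intro holomorphic_intros holomorphic_on_subset[OF FY_hol]) (auto simp: slit)
  have L_sums: "(\<lambda>n. g n * z ^ n) sums L z" if "norm z < R" for z
    using powser_inside[OF summable_T, of z] that by (simp add: L_def R_def summable_sums)
  have L_hol: "L holomorphic_on ball 0 R"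
    by (rule power_series_holomorphic[where a = g]) (simp add: L_sums)

  \<comment> \<open>The identity theorem, starting from the small disc around 0.\<close>
  have slit_eq: "L z = G z" if z: "z \<in> ball 0 R \<inter> slit_exterior (norm X)" for z
  proof (rule analytic_continuation_open[where f = L and g = G and s = "ball 0 (min R (1 / 8))" and s' = "ball 0 R \<inter> slit_exterior (norm X)"])
    show "ball 0 (min R (1 / 8)) \<subseteq> ball 0 R \<inter> slit_exterior (norm X)"
    proof
      fix w :: complex assume w: "w \<in> ball 0 (min R (1 / 8))"
      have "norm X * norm w \<le> norm w" using X by (simp add: mult_left_le_one_le)
      moreover have "norm (1 - w) \<ge> 1 - norm w" by (metis norm_one norm_triangle_ineq2)
      moreover have "Re w < 1" using w complex_Re_le_cmod[of w] by simp
      ultimately show "w \<in> ball 0 R \<inter> slit_exterior (norm X)"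
        using w by (auto simp: slit_exterior_def complex_nonpos_Reals_iff)
    qed
    show "L w = G w" if "w \<in> ball 0 (min R (1 / 8))" for w
      using hyp2F1_appell_generating_function_small[OF b X, of w l r a] that
      by (simp add: L_def G_def Y_def g_def sums_iff)
    show "L holomorphic_on ball 0 R \<inter> slit_exterior (norm X)" "G holomorphic_on ball 0 R \<inter> slit_exterior (norm X)"
      by (auto intro: holomorphic_on_subset[OF L_hol] holomorphic_on_subset[OF G_hol])
    show "connected (ball 0 R \<inter> slit_exterior (norm X))"
      using X R by (intro connected_disc_Int_slit_exterior) auto
    show "open (ball 0 R \<inter> slit_exterior (norm X))"
      by (intro open_Int open_ball open_slit_exterior)
  qed (use R z in auto)

  have G_cont_lower: "continuous (at z within {w. Im w \<le> 0}) G" if "z \<in> D" "Im z \<le> 0" for z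
  proof -
    have "isCont (\<lambda>z. appell_F1 a r l b X (Y z)) z"
      using holomorphic_on_imp_continuous_on[OF FY_hol] that open_D
      by (simp add: continuous_on_eq_continuous_at)
    note factor_cont = continuous_at_imp_continuous_within[OF this]
    show ?thesis
      unfolding G_def
      by (rule continuous_mult[OF continuous_one_minus_powr_lower_half_plane[OF D_neq[OF that(1)] that(2)] factor_cont])
  qed

  \<comment> \<open>Points on the slit are approached vertically from below.\<close>
  have disc_eq: "L z = G z" if z: "z \<in> D" "norm z < R" for z
  proof (cases "1 - z \<in> \<real>\<^sub>\<le>\<^sub>0")
    case False
    then show ?thesis using z by (intro slit_eq) (auto simp: slit)
  next
    case True
    then have Im: "Im z = 0" by (simp add: complex_nonpos_Reals_iff)
    define w where "w n = z - \<i> * of_real (inverse (of_nat (Suc n)))" for n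
    have "w \<longlonglongrightarrow> z - \<i> * of_real 0"
      unfolding w_def by (intro tendsto_intros LIMSEQ_inverse_real_of_nat)
    then have w: "w \<longlonglongrightarrow> z" by simp
    have Im_w: "Im (w n) < 0" for n
      by (simp add: w_def Im)
    have "isCont L z"
      using holomorphic_on_imp_continuous_on[OF L_hol] z
      by (simp add: continuous_on_eq_continuous_at)
    then have L_lim: "(\<lambda>n. L (w n)) \<longlonglongrightarrow> L z"
      using w by (rule isCont_tendsto_compose)
    have G_lim: "(\<lambda>n. G (w n)) \<longlonglongrightarrow> G z"
      using Im_w by (intro continuous_within_tendsto_compose'[OF G_cont_lower _ w]) (auto simp: z Im less_imp_le)
    have "eventually (\<lambda>n. w n \<in> D \<inter> ball 0 R) sequentially"
      using z open_D by (intro topological_tendstoD[OF w]) auto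
    then have "eventually (\<lambda>n. L (w n) = G (w n)) sequentially"
    proof eventually_elim
      case (elim n)
      have "1 - w n \<notin> \<real>\<^sub>\<le>\<^sub>0" using Im_w[of n] by (auto simp: complex_nonpos_Reals_iff)
      then show ?case using elim by (intro slit_eq) (auto simp: slit)
    qed
    then have "(\<lambda>n. G (w n)) \<longlonglongrightarrow> L z"
      using L_lim by (rule Lim_transform_eventually[rotated])
    from tendsto_unique[OF _ this G_lim] show ?thesis by simp
  qed

  \<comment> \<open>The radius to \<open>T\<close> stays on the slit if \<open>T\<close> lies on it, since then \<open>T\<close> is real; along it \<open>G\<close> is
    still continuous as seen from the lower half plane.\<close>
  have radius_lim: "((\<lambda>s::real. of_real s * T) \<longlongrightarrow> T) (at_left 1)"
  proof -
    have "((\<lambda>s::real. of_real s * T) \<longlongrightarrow> of_real 1 * T) (at_left 1)"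
      by (intro tendsto_intros)
    then show ?thesis by simp
  qed
  have "((\<lambda>s::real. \<Sum>n. g n * T ^ n * of_real s ^ n) \<longlongrightarrow> L T) (at_left 1)"
    using summable_sums[OF summable_T] unfolding L_def by (rule Abel_limit_radial)
  then have L_lim: "((\<lambda>s::real. L (of_real s * T)) \<longlongrightarrow> L T) (at_left 1)"
    by (simp add: L_def power_mult_distrib mult_ac)
  have G_lim: "((\<lambda>s::real. G (of_real s * T)) \<longlongrightarrow> G T) (at_left 1)"
  proof (cases "1 - T \<in> \<real>\<^sub>\<le>\<^sub>0")
    case True
    then have "Im T = 0" by (simp add: complex_nonpos_Reals_iff)
    then show ?thesis
      by (intro continuous_within_tendsto_compose[OF G_cont_lower _ radius_lim] T_D) auto
  next
    case False
    then have "isCont G T"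
      using holomorphic_on_imp_continuous_on[OF G_hol] T_D
      by (simp add: continuous_on_eq_continuous_at[OF open_slit_exterior]) (simp add: slit)
    then show ?thesis using radius_lim by (rule isCont_tendsto_compose)
  qed
  have "eventually (\<lambda>s::real. of_real s * T \<in> D) (at_left 1)"
    using open_D T_D by (intro topological_tendstoD[OF radius_lim])
  moreover have "eventually (\<lambda>s::real. 0 < s \<and> s < 1) (at_left 1)"
    using eventually_at_left_real[of 0 "1::real"] by simp
  ultimately have "eventually (\<lambda>s::real. L (of_real s * T) = G (of_real s * T)) (at_left 1)"
  proof eventually_elim
    case (elim s)
    then show ?case using R by (intro disc_eq) (auto simp: norm_mult R_def)
  qed
  then have "((\<lambda>s::real. G (of_real s * T)) \<longlongrightarrow> L T) (at_left 1)"
    using L_lim by (rule Lim_transform_eventually[rotated])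
  from tendsto_unique[OF _ this G_lim] have "L T = G T" by simp
  then show ?thesis by (simp add: L_def G_def Y_def g_def)
qed

section \<open>Scaling to general k\<close>

lemma pochhammer_k_conv_pochhammer:
  assumes "k > 0"
  shows "pochhammer_k k a n = of_real k ^ n * pochhammer (a / of_real k) n"
proof -
  have "a + of_nat i * of_real k = of_real k * (a / of_real k + of_nat i)" for i
    using assms by (simp add: field_simps)
  then have "pochhammer_k k a n = (\<Prod>i<n. of_real k * (a / of_real k + of_nat i))"
    unfolding pochhammer_k_def by (simp only:)
  then show ?thesis
    by (simp add: prod.distrib pochhammer_prod lessThan_atLeast0)
qed

lemma hypergeo_2F1_k_conv_hyp2F1:
  assumes "k > 0"
  shows "hypergeo_2F1_k k \<alpha> \<beta> \<gamma> x =
           hyp2F1 (\<alpha> / of_real k) (\<beta> / of_real k) (\<gamma> / of_real k) (of_real k * x)"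
  unfolding hypergeo_2F1_k_def hyp2F1_def pochhammer_k_conv_pochhammer[OF assms] power_mult_distrib
  using assms by (intro suminf_cong) simp

lemma appell_F1_k_conv_appell_F1:
  assumes "k > 0"
  shows "appell_F1_k k \<alpha> \<beta> \<beta>' \<gamma> x y =
           appell_F1 (\<alpha> / of_real k) (\<beta> / of_real k) (\<beta>' / of_real k) (\<gamma> / of_real k) (of_real k * x) (of_real k * y)"
  unfolding appell_F1_k_def appell_F1_def appell_term_def pochhammer_k_conv_pochhammer[OF assms] power_mult_distrib
  using assms by (intro infsum_cong) (auto simp: mult_ac)

text \<open>Since \<open>pochhammer_k k a n\<close> is \<open>k ^ n\<close> times the Pochhammer symbol of \<open>a / k\<close>, all parameters are
  divided by \<open>k\<close> and all arguments multiplied by \<open>k\<close>.\<close>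

theorem theorem16:
  fixes k :: real and lam \<rho> \<alpha> \<beta> x t :: complex
  assumes "k > 0"
    and "\<And>j::nat. \<beta> \<noteq> - (of_nat j * of_real k)"
    and "norm x < 1 / k"
    and "of_real k * t \<noteq> 1"
    and "norm (of_real k * x * t / (1 - of_real k * t)) < 1 / k"
  shows "(norm (of_real k * t) < 1 \<and> norm (of_real k * t * (1 - of_real k * x)) < 1 \<longrightarrow>
            summable (\<lambda>n. pochhammer_k k lam n / fact n *
              hypergeo_2F1_k k (\<rho> - of_nat n * of_real k) \<alpha> \<beta> x * t ^ n)) \<and>
         (summable (\<lambda>n. pochhammer_k k lam n / fact n *
              hypergeo_2F1_k k (\<rho> - of_nat n * of_real k) \<alpha> \<beta> x * t ^ n) \<longrightarrow>
            (\<Sum>n. pochhammer_k k lam n / fact n *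
              hypergeo_2F1_k k (\<rho> - of_nat n * of_real k) \<alpha> \<beta> x * t ^ n) =
            (1 - of_real k * t) powr (- (lam / of_real k)) *
              appell_F1_k k \<alpha> \<rho> lam \<beta> x (- (of_real k * x * t / (1 - of_real k * t))))"
proof -
  define X T where "X = of_real k * x" and "T = of_real k * t"
  define a b r l where "a = \<alpha> / of_real k" and "b = \<beta> / of_real k" and "r = \<rho> / of_real k" and "l = lam / of_real k"
  have k: "k > 0" "complex_of_real k \<noteq> 0" using assms(1) by auto
  have b: "b \<notin> \<int>\<^sub>\<le>\<^sub>0"
  proof
    assume "b \<in> \<int>\<^sub>\<le>\<^sub>0"
    then obtain j where "b = - of_nat j" by (auto elim: nonpos_Ints_cases')
    then have "\<beta> = - (of_nat j * of_real k)"
      using k by (simp add: b_def field_simps)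
    with assms(2) show False by blast
  qed
  have X: "norm X < 1"
    using assms(1,3) by (simp add: X_def norm_mult field_simps)
  have T: "T \<noteq> 1" using assms(4) by (simp add: T_def)
  have "norm (X * T / (1 - T)) = k * norm (of_real k * x * t / (1 - of_real k * t))"
    using assms(1) by (simp add: X_def T_def norm_mult norm_divide)
  also have "\<dots> < 1"
    using assms(1,5) by (simp add: pos_less_divide_eq mult.commute)
  finally have XT: "norm (X * T / (1 - T)) < 1" .
  have lowered: "(\<rho> - of_nat n * of_real k) / of_real k = r - of_nat n" for n
    using k by (simp add: r_def diff_divide_distrib)
  have terms: "pochhammer_k k lam n / fact n * hypergeo_2F1_k k (\<rho> - of_nat n * of_real k) \<alpha> \<beta> x * t ^ n
      = pochhammer l n / fact n * hyp2F1 (r - of_nat n) a b X * T ^ n" for n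
    unfolding hypergeo_2F1_k_conv_hyp2F1[OF k(1)] pochhammer_k_conv_pochhammer[OF k(1)] lowered
    by (simp add: a_def b_def l_def X_def T_def power_mult_distrib)
  have argument: "of_real k * - (of_real k * x * t / (1 - of_real k * t)) = - (X * T / (1 - T))"
    by (simp add: X_def T_def)
  have appell: "appell_F1_k k \<alpha> \<rho> lam \<beta> x (- (of_real k * x * t / (1 - of_real k * t)))
      = appell_F1 a r l b X (- (X * T / (1 - T)))"
    unfolding appell_F1_k_conv_appell_F1[OF k(1)] argument
    by (simp only: a_def b_def r_def l_def X_def)
  show ?thesis
    unfolding terms appell
    using hyp2F1_lowered_parameter_summable[OF b X, of T l r a]
      hyp2F1_appell_generating_function[OF b X T XT, of l r a]
    by (simp add: T_def X_def l_def)
qed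

end
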